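(* For every Tychonoff space $X$ there exist a Tychonoff space $Y$ of weight $w(Y)=w(X)$ and a homeomorphism $\pi_0(Y)\cong X$ such that the quotient map $q_Y:Y\to \pi_0(Y)\cong X$ is perfect, i.e. closed with compact preimages of points.
   Context: For a topological space $Y$, the path-component space $\pi_0(Y)$ is the set of path components of $Y$ equipped with the quotient topology with respect to the map $q_Y:Y\to\pi_0(Y)$, $q_Y(y)=[y]$, sending each point to its path component. A Tychonoff space is a completely regular Hausdorff space. The weight $w(X)$ of a space $X$ is the minimal cardinality of a basis generating the topology of $X$. A map (continuous function) $f:A\to B$ is perfect if $A$ is Hausdorff, $f$ is a closed map, and $f^{-1}(b)$ is compact for each $b\in B$. *)

theory Defs
  imports "HOL-Analysis.Analysis"
begin

unbundle cardinal_syntax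

definition tychonoff_space :: "'a topology \<Rightarrow> bool" where
  "tychonoff_space X \<longleftrightarrow> completely_regular_space X \<and> Hausdorff_space X"

text \<open>
  The library's \<^const>\<open>perfect_map\<close> demands surjectivity but not that the domain is Hausdorff; the
  notion used here is the other way round. \<^const>\<open>proper_map\<close> says: closed, with compact point
  preimages.
\<close>

definition hausdorff_perfect_map :: "'a topology \<Rightarrow> 'b topology \<Rightarrow> ('a \<Rightarrow> 'b) \<Rightarrow> bool" where
  "hausdorff_perfect_map A B f \<longleftrightarrow>
     Hausdorff_space A \<and> continuous_map A B f \<and> proper_map A B f"

definition topology_basis :: "'a topology \<Rightarrow> 'a set set \<Rightarrow> bool" where
  "topology_basis X \<B> \<longleftrightarrow> openin X = arbitrary union_of (\<lambda>V. V \<in> \<B>)"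

text \<open>
  The weight is the cardinal of a basis of least cardinality, without the convention that forces
  it to be infinite. Cardinals are well-orders, so weights are compared with \<open>=o\<close> and \<open>\<le>o\<close>, which
  also makes sense for spaces over different types.
\<close>

definition weight :: "'a topology \<Rightarrow> 'a set rel" where
  "weight X =
     |SOME \<B>. topology_basis X \<B> \<and> (\<forall>\<C>. topology_basis X \<C> \<longrightarrow> |\<B>| \<le>o |\<C>| )|"

lemma topology_basis_openin: "topology_basis X {U. openin X U}"
  unfolding topology_basis_def
  by (subst openin_topology_base_unique) auto

lemma minimal_topology_basis_exists:
  "\<exists>\<B>. topology_basis X \<B> \<and> (\<forall>\<C>. topology_basis X \<C> \<longrightarrow> |\<B>| \<le>o |\<C>| )"
proof -
  let ?R = "card_of ` {\<B>. topology_basis X \<B>}"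
  have "?R \<noteq> {}"
    using topology_basis_openin by blast
  moreover have "\<forall>r\<in>?R. Card_order r"
    by (auto simp: card_of_Card_order)
  ultimately have "\<exists>r\<in>?R. \<forall>r'\<in>?R. r \<le>o r'"
    by (rule exists_minim_Card_order)
  then show ?thesis
    by auto
qed

lemma weight_basis_exists: "\<exists>\<B>. topology_basis X \<B> \<and> weight X = |\<B>|"
  unfolding weight_def using someI_ex[OF minimal_topology_basis_exists[of X]] by blast

lemma weight_le: "topology_basis X \<C> \<Longrightarrow> weight X \<le>o |\<C>|"
  unfolding weight_def using someI_ex[OF minimal_topology_basis_exists[of X]] by blast

definition path_component_space :: "'a topology \<Rightarrow> 'a set topology" where
  "path_component_space Y =
     topology (\<lambda>\<U>. \<U> \<subseteq> path_components_of Y \<and>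
                    openin Y {y \<in> topspace Y. path_component_of_set Y y \<in> \<U>})"

lemma openin_path_component_space:
  "openin (path_component_space Y) \<U> \<longleftrightarrow>
     \<U> \<subseteq> path_components_of Y \<and>
     openin Y {y \<in> topspace Y. path_component_of_set Y y \<in> \<U>}"
proof -
  let ?q = "path_component_of_set Y"
  have "istopology (\<lambda>\<U>. \<U> \<subseteq> path_components_of Y \<and> openin Y {y \<in> topspace Y. ?q y \<in> \<U>})"
    unfolding istopology_def
  proof (intro conjI allI impI)
    fix \<U> \<V>
    assume *: "\<U> \<subseteq> path_components_of Y \<and> openin Y {y \<in> topspace Y. ?q y \<in> \<U>}"
      "\<V> \<subseteq> path_components_of Y \<and> openin Y {y \<in> topspace Y. ?q y \<in> \<V>}"
    have "{y \<in> topspace Y. ?q y \<in> \<U> \<inter> \<V>} =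
          {y \<in> topspace Y. ?q y \<in> \<U>} \<inter> {y \<in> topspace Y. ?q y \<in> \<V>}"
      by blast
    with * show "openin Y {y \<in> topspace Y. ?q y \<in> \<U> \<inter> \<V>}"
      by (metis (no_types, lifting) openin_Int)
    show "\<U> \<inter> \<V> \<subseteq> path_components_of Y"
      using * by blast
  next
    fix \<K>
    assume *: "\<forall>\<U>\<in>\<K>. \<U> \<subseteq> path_components_of Y \<and> openin Y {y \<in> topspace Y. ?q y \<in> \<U>}"
    have "{y \<in> topspace Y. ?q y \<in> \<Union>\<K>} = (\<Union>\<U>\<in>\<K>. {y \<in> topspace Y. ?q y \<in> \<U>})"
      by blast
    with * show "openin Y {y \<in> topspace Y. ?q y \<in> \<Union>\<K>}"
      by auto
    show "\<Union>\<K> \<subseteq> path_components_of Y"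
      using * by blast
  qed
  then show ?thesis
    by (simp add: path_component_space_def topology_inverse')
qed

lemma topspace_path_component_space:
  "topspace (path_component_space Y) = path_components_of Y"
proof
  show "topspace (path_component_space Y) \<subseteq> path_components_of Y"
    using openin_path_component_space[of Y "topspace (path_component_space Y)"] by simp
  have "{y \<in> topspace Y. path_component_of_set Y y \<in> path_components_of Y} = topspace Y"
    by (auto simp: path_components_of_def)
  then have "openin (path_component_space Y) (path_components_of Y)"
    by (simp add: openin_path_component_space)
  then show "path_components_of Y \<subseteq> topspace (path_component_space Y)"
    by (rule openin_subset)
qed

lemma quotient_map_path_component_of_set:
  "quotient_map Y (path_component_space Y) (path_component_of_set Y)"
  unfolding quotient_map_def topspace_path_component_space openin_path_component_space
  by (auto simp: path_components_of_def)

end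

theory Submission
  imports Defs "HOL-Algebra.Free_Abelian_Groups"
begin

text \<open>
  The closed topologist's sine curve is the set of pairs \<open>(u, v)\<close> with \<open>\<bar>v\<bar> \<le> 1\<close> and
  \<open>u * v = u * sin (1 / u)\<close>. Projected to the first coordinate it has compact convex fibres: a point
  over \<open>u \<noteq> 0\<close>, a segment over \<open>0\<close>. Yet no path in it leads from \<open>u < 0\<close> to \<open>u > 0\<close>, because the
  second coordinate would oscillate without limit on the way to \<open>u = 0\<close>.

  This obstruction can be installed in front of an arbitrary Tychonoff space \<open>X\<close>. Take continuous
  functions \<open>\<psi> i\<close>, \<open>i \<in> I\<close>, such that for any two distinct points some \<open>\<psi> i\<close> is negative at the first
  and positive at the second, and let \<open>Z\<close> consist of the pairs \<open>(x, z)\<close> with \<open>(\<psi> i x, z i)\<close> on the sine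
  curve for every \<open>i\<close>. Over \<open>x\<close> lies a product of points and segments, which is compact and path
  connected; in fact \<open>Z\<close> is closed in \<open>X \<times> [-1, 1]\<^sup>I\<close>, so its projection to \<open>X\<close> is perfect. A path in
  \<open>Z\<close> between different fibres would give, for a suitable \<open>i\<close>, a path on the sine curve that crosses
  \<open>0\<close>. Hence the fibres are exactly the path components, and as a perfect surjection is a quotient
  map, the path-component space of \<open>Z\<close> is \<open>X\<close>.

  If the weight of \<open>X\<close> is infinite, the separating functions can be indexed by pairs of members of a
  least basis, so \<open>|I|\<close> is at most the weight of \<open>X\<close>, and the weight of \<open>Z\<close> does not exceed it.
  Conversely a perfect image has at most the weight of its domain. If the weight is finite, \<open>Z\<close> could
  be too large, since segments have infinite weight; but then \<open>X\<close> is finite and discrete, and is its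
  own path-component space.
\<close>

section \<open>Paths on the closed sine curve\<close>

lemma continuous_on_mult_sin_inverse: "continuous_on UNIV (\<lambda>u::real. u * sin (1 / u))"
proof -
  have "isCont (\<lambda>u::real. u * sin (1 / u)) u" for u
  proof (cases "u = 0")
    case False
    then show ?thesis by (intro continuous_intros) auto
  next
    case True
    have "((\<lambda>u::real. u * sin (1 / u)) \<longlongrightarrow> 0) (at 0)"
    proof (rule tendsto_0_le[where K = 1])
      show "((\<lambda>u::real. u) \<longlongrightarrow> 0) (at 0)" by (rule tendsto_ident_at)
      show "\<forall>\<^sub>F u in at 0. norm (u * sin (1 / u)) \<le> norm (u::real) * 1"
        by (intro always_eventually allI) (auto simp: abs_mult intro!: mult_left_le)
    qed
    with True show ?thesis by (simp add: isCont_def)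
  qed
  then show ?thesis
    by (simp add: continuous_at_imp_continuous_on)
qed

text \<open>
  Let \<open>s0\<close> be the first zero of \<open>p\<close>. Just before \<open>s0\<close> the function \<open>p\<close> runs through all small negative
  values by the intermediate value theorem, so \<open>q\<close>, which there equals \<open>sin (1 / p)\<close>, takes both values
  \<open>1\<close> and \<open>-1\<close> arbitrarily close to \<open>s0\<close>. This contradicts the continuity of \<open>q\<close> at \<open>s0\<close>. In particular
  such a path does not even reach the segment over \<open>0\<close>.
\<close>
lemma path_on_sine_curve_stays_negative:
  fixes p q :: "real \<Rightarrow> real"
  assumes p: "continuous_on {0..1} p" and q: "continuous_on {0..1} q"
    and eq: "\<And>s. s \<in> {0..1} \<Longrightarrow> p s * q s = p s * sin (1 / p s)"
    and start: "p 0 < 0"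
  shows "p 1 < 0"
proof (rule ccontr)
  assume "\<not> p 1 < 0"
  define S where "S = {s \<in> {0..1}. p s = 0}"
  define s0 where "s0 = Inf S"
  have hit: "\<exists>s. a \<le> s \<and> s \<le> b \<and> p s = v"
    if "0 \<le> a" "a \<le> b" "b \<le> 1" "p a \<le> v" "v \<le> p b" for a b v
    using IVT'[of p a v b] that continuous_on_subset[OF p, of "{a..b}"] by auto
  have "S \<noteq> {}"
    using hit[of 0 1 0] start \<open>\<not> p 1 < 0\<close> by (auto simp: S_def)
  have "closed S"
    unfolding S_def using continuous_closed_preimage_constant[OF p, of 0] by simp
  have "bdd_below S"
    by (auto simp: S_def intro: bdd_belowI[of _ 0])
  have "s0 \<in> S"
    unfolding s0_def using \<open>S \<noteq> {}\<close> \<open>bdd_below S\<close> \<open>closed S\<close> by (rule closed_contains_Inf)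
  then have s0: "0 \<le> s0" "s0 \<le> 1" "p s0 = 0"
    by (auto simp: S_def)
  with start have "0 < s0"
    by (cases "s0 = 0") auto
  have neg: "p s < 0" if s: "0 \<le> s" "s < s0" for s
  proof (rule ccontr)
    assume "\<not> p s < 0"
    then obtain r where "0 \<le> r" "r \<le> s" "p r = 0"
      using hit[of 0 s 0] s start s0 by auto
    then have "r \<in> S" using that s0 by (auto simp: S_def)
    then have "s0 \<le> r" unfolding s0_def using \<open>bdd_below S\<close> by (rule cInf_lower)
    with \<open>r \<le> s\<close> that show False by simp
  qed
  obtain d where "d > 0" and d: "\<And>s. \<lbrakk>s \<in> {0..1}; dist s s0 < d\<rbrakk> \<Longrightarrow> dist (q s) (q s0) < 1"
    using q s0 unfolding continuous_on_iff by (metis atLeastAtMost_iff zero_less_one)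
  define a where "a = max 0 (s0 - d / 2)"
  have a: "0 \<le> a" "a < s0" "s0 - a < d"
    using \<open>0 < s0\<close> \<open>0 < d\<close> by (auto simp: a_def)
  have "p a < 0" using neg a by simp
  have near: "dist (sin (1 / v)) (q s0) < 1" if v: "p a \<le> v" "v < 0" for v
  proof -
    obtain s where s: "a \<le> s" "s \<le> s0" "p s = v"
      using hit[of a s0 v] a s0 v by auto
    have "q s = sin (1 / v)"
      using eq[of s] s v a s0 by auto
    moreover have "dist (q s) (q s0) < 1"
      using d[of s] s a s0 by (auto simp: dist_real_def)
    ultimately show ?thesis by simp
  qed
  \<comment> \<open>The values \<open>-1 / x\<close> and \<open>-1 / y\<close> below lie in \<open>[p a, 0)\<close> once \<open>n\<close> is large; they are
    points where \<open>sin (1 / v)\<close> is \<open>-1\<close> and \<open>1\<close>.\<close>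
  obtain n :: nat where n: "1 - 1 / p a < real n"
    using reals_Archimedean2 by blast
  have "1 / p a < 0" using \<open>p a < 0\<close> by simp
  have np: "real n * 3 \<le> real n * pi"
    using pi_gt3 by (intro mult_left_mono) auto
  define x y where "x = 2 * real n * pi + pi / 2" and "y = 2 * real n * pi - pi / 2"
  have "y > - (1 / p a)" "y > 0"
    using n np \<open>1 / p a < 0\<close> pi_less_4 unfolding y_def by linarith+
  moreover have "x > y" using pi_gt_zero by (simp add: x_def y_def)
  ultimately have xy: "x > - (1 / p a)" "x > 0" "y > - (1 / p a)" "y > 0" by auto
  have le: "p a \<le> - (1 / w)" if "w > - (1 / p a)" "w > 0" for w
    using that \<open>p a < 0\<close> by (simp add: field_simps)
  have "sin x = 1" "sin y = -1"
    by (simp_all add: x_def y_def sin_add sin_diff)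
  then show False
    using near[of "- (1 / x)"] near[of "- (1 / y)"] le xy by (simp add: dist_real_def)
qed

lemma path_on_sine_curve_cannot_cross:
  fixes p q :: "'a \<Rightarrow> real"
  assumes "path_component_of Z a b"
    and p: "continuous_map Z euclideanreal p" and q: "continuous_map Z euclideanreal q"
    and eq: "\<And>w. w \<in> topspace Z \<Longrightarrow> p w * q w = p w * sin (1 / p w)"
    and "p a < 0"
  shows "p b < 0"
proof -
  obtain g where g: "pathin Z g" "g 0 = a" "g 1 = b"
    using assms(1) by (auto simp: path_component_of_def)
  have cont: "continuous_on {0..1} (f \<circ> g)" if "continuous_map Z euclideanreal f" for f :: "'a \<Rightarrow> real"
    using continuous_map_compose[OF _ that, of "top_of_set {0..1}" g] g
    by (simp add: pathin_def)
  have top: "g s \<in> topspace Z" if "s \<in> {0..1}" for s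
    using g(1) that by (auto simp: pathin_def continuous_map_def)
  have "(p \<circ> g) 1 < 0"
  proof (rule path_on_sine_curve_stays_negative[OF cont[OF p] cont[OF q]])
    show "(p \<circ> g) s * (q \<circ> g) s = (p \<circ> g) s * sin (1 / (p \<circ> g) s)" if "s \<in> {0..1}" for s
      using eq top[OF that] by simp
  qed (use g assms in auto)
  with g show ?thesis by simp
qed

section \<open>Weight\<close>

lemma topology_basis_iff:
  "topology_basis X \<B> \<longleftrightarrow>
     (\<forall>U\<in>\<B>. openin X U) \<and> (\<forall>W x. openin X W \<and> x \<in> W \<longrightarrow> (\<exists>U\<in>\<B>. x \<in> U \<and> U \<subseteq> W))"
  unfolding topology_basis_def openin_topology_base_unique by blast

text \<open>
  Finite intersections of a family indexed by an infinite set are no more numerous than the index set,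
  so a subbase already bounds an infinite weight.
\<close>
lemma weight_le_of_subbase:
  assumes "\<And>U. U \<in> \<S> \<Longrightarrow> openin Z U"
    and sub: "\<And>W x. \<lbrakk>openin Z W; x \<in> W\<rbrakk> \<Longrightarrow>
           \<exists>F. finite F \<and> F \<subseteq> \<S> \<and> x \<in> topspace Z \<inter> \<Inter>F \<and> topspace Z \<inter> \<Inter>F \<subseteq> W"
    and le: "|\<S>| \<le>o |C|" and inf: "infinite C"
  shows "weight Z \<le>o |C|"
proof -
  let ?\<B> = "(\<lambda>F. topspace Z \<inter> \<Inter>F) ` Fpow \<S>"
  have "openin Z (topspace Z \<inter> \<Inter>F)" if "F \<in> Fpow \<S>" for F
    using that assms(1) by (cases "F = {}") (auto simp: Fpow_def intro!: openin_Int openin_Inter)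
  moreover have "\<exists>U\<in>?\<B>. x \<in> U \<and> U \<subseteq> W" if W: "openin Z W" "x \<in> W" for W x
  proof -
    obtain F where "finite F" "F \<subseteq> \<S>" "x \<in> topspace Z \<inter> \<Inter>F" "topspace Z \<inter> \<Inter>F \<subseteq> W"
      using sub[OF W] by blast
    then show ?thesis by (auto simp: Fpow_def)
  qed
  ultimately have "topology_basis Z ?\<B>"
    unfolding topology_basis_iff by auto
  then have "weight Z \<le>o |?\<B>|" by (rule weight_le)
  also have "|?\<B>| \<le>o |Fpow \<S>|" by (rule card_of_image)
  also have "|Fpow \<S>| \<le>o |Fpow C|" by (rule card_of_Fpow_mono[OF le])
  also have "|Fpow C| =o |C|" using inf by simp
  finally show ?thesis .
qed

lemma weight_open_image_le:
  assumes f: "continuous_map Z Y f" "open_map Z Y f" "f ` topspace Z = topspace Y"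
  shows "weight Y \<le>o weight Z"
proof -
  obtain \<B> where B: "topology_basis Z \<B>" "weight Z = |\<B>|"
    using weight_basis_exists by blast
  have "topology_basis Y ((`) f ` \<B>)"
    unfolding topology_basis_iff
  proof (intro conjI ballI allI impI)
    show "openin Y U" if "U \<in> (`) f ` \<B>" for U
      using that f(2) B(1) by (auto simp: topology_basis_iff open_map_def)
  next
    fix W y assume "openin Y W \<and> y \<in> W"
    then have W: "openin Y W" "y \<in> W" by auto
    then obtain x where x: "x \<in> topspace Z" "f x = y"
      using f(3) openin_subset by (metis imageE subsetD)
    have "openin Z {x \<in> topspace Z. f x \<in> W}"
      using f(1) W(1) by (rule openin_continuous_map_preimage)
    then obtain U where "U \<in> \<B>" "x \<in> U" "U \<subseteq> {x \<in> topspace Z. f x \<in> W}"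
      using B(1) x W unfolding topology_basis_iff by blast
    then show "\<exists>V\<in>(`) f ` \<B>. y \<in> V \<and> V \<subseteq> W"
      using x by blast
  qed
  then have "weight Y \<le>o |(`) f ` \<B>|" by (rule weight_le)
  also have "|(`) f ` \<B>| \<le>o |\<B>|" by (rule card_of_image)
  finally show ?thesis using B by simp
qed

lemma weight_homeomorphic:
  assumes "homeomorphic_map Z Y f"
  shows "weight Y =o weight Z"
proof -
  obtain g where g: "homeomorphic_maps Z Y f g"
    using assms unfolding homeomorphic_map_maps by (elim exE) (rule that)
  have "weight Y \<le>o weight Z"
    using assms unfolding homeomorphic_eq_everything_map
    by (intro weight_open_image_le[of Z Y f]) auto
  moreover have "weight Z \<le>o weight Y"
    using g unfolding homeomorphic_maps_map homeomorphic_eq_everything_map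
    by (intro weight_open_image_le[of Y Z g]) auto
  ultimately show ?thesis by (simp add: ordIso_iff_ordLeq)
qed

text \<open>
  Images of open sets under a closed map need not be open, so a basis is transported by the dual
  operation: \<open>core F\<close> is the set of points whose whole fibre lies in \<open>\<Union>F\<close>. It is open because the map is
  closed. Since a fibre is compact, finitely many basic sets suffice to cover it inside a given open
  set; this is why finite families \<open>F\<close> are enough, and for an infinite basis they do not raise the
  cardinality.
\<close>
lemma weight_perfect_image_le:
  assumes f: "continuous_map Z X f" "proper_map Z X f" "f ` topspace Z = topspace X"
    and inf: "infinite (Field (weight X))"
  shows "weight X \<le>o weight Z"
proof -
  obtain \<C> where C: "topology_basis Z \<C>" "weight Z = |\<C>|"
    using weight_basis_exists by blast
  define core where "core F = topspace X - f ` (topspace Z - \<Union>F)" for F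
  have "topology_basis X (core ` Fpow \<C>)"
    unfolding topology_basis_iff
  proof (intro conjI ballI allI impI)
    fix U assume "U \<in> core ` Fpow \<C>"
    then obtain F where F: "F \<in> Fpow \<C>" "U = core F" by blast
    have "closedin Z (topspace Z - \<Union>F)"
      using F(1) C(1) by (intro closedin_diff closedin_topspace openin_Union)
        (auto simp: Fpow_def topology_basis_iff)
    then have "closedin X (f ` (topspace Z - \<Union>F))"
      using f(2) by (auto simp: proper_map_def closed_map_def)
    then show "openin X U" by (auto simp: F core_def)
  next
    fix W x assume "openin X W \<and> x \<in> W"
    then have W: "openin X W" "x \<in> W" "x \<in> topspace X"
      using openin_subset by blast+
    define P where "P = {z \<in> topspace Z. f z \<in> W}"
    have "openin Z P"
      unfolding P_def using f(1) W(1) by (rule openin_continuous_map_preimage)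
    define \<U> where "\<U> = {U \<in> \<C>. U \<subseteq> P}"
    have "compactin Z {z \<in> topspace Z. f z = x}"
      using f(2) W by (auto simp: proper_map_def)
    moreover have "openin Z U" if "U \<in> \<U>" for U
      using that C(1) by (auto simp: \<U>_def topology_basis_iff)
    moreover have "{z \<in> topspace Z. f z = x} \<subseteq> \<Union>\<U>"
    proof
      fix z assume "z \<in> {z \<in> topspace Z. f z = x}"
      then have "z \<in> P" using W by (auto simp: P_def)
      then obtain U where "U \<in> \<C>" "z \<in> U" "U \<subseteq> P"
        using C(1) \<open>openin Z P\<close> unfolding topology_basis_iff by blast
      then show "z \<in> \<Union>\<U>" by (auto simp: \<U>_def)
    qed
    ultimately have "\<exists>F. finite F \<and> F \<subseteq> \<U> \<and> {z \<in> topspace Z. f z = x} \<subseteq> \<Union>F"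
      by (rule compactinD)
    then obtain F where F: "finite F" "F \<subseteq> \<U>" "{z \<in> topspace Z. f z = x} \<subseteq> \<Union>F"
      by blast
    have "core F \<subseteq> W"
    proof
      fix y assume y: "y \<in> core F"
      then obtain z where z: "z \<in> topspace Z" "y = f z"
        using f(3) by (auto simp: core_def)
      with y have "z \<in> \<Union>F" by (auto simp: core_def)
      then have "z \<in> P" using F(2) by (auto simp: \<U>_def)
      then show "y \<in> W" using z by (simp add: P_def)
    qed
    moreover have "x \<in> core F" using F(3) W by (auto simp: core_def)
    moreover have "F \<in> Fpow \<C>" using F by (auto simp: Fpow_def \<U>_def)
    ultimately show "\<exists>U\<in>core ` Fpow \<C>. x \<in> U \<and> U \<subseteq> W" by blast
  qed
  then have "weight X \<le>o |core ` Fpow \<C>|" by (rule weight_le)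
  also have "|core ` Fpow \<C>| \<le>o |Fpow \<C>|" by (rule card_of_image)
  finally have le: "weight X \<le>o |Fpow \<C>|" .
  \<comment> \<open>A finite \<open>\<C>\<close> would bound the weight of \<open>X\<close> by a finite number.\<close>
  have "infinite (Fpow \<C>)"
    using card_of_ordLeq_infinite le inf weight_basis_exists[of X] Field_card_of by metis
  then have "infinite \<C>"
    by (metis Fpow_Pow_finite finite_Int finite_Pow_iff)
  then have "|Fpow \<C>| =o |\<C>|" by simp
  with le C(2) show ?thesis by (metis ordLeq_ordIso_trans)
qed

section \<open>The sine pullback\<close>

text \<open>
  The pullback along \<open>(\<psi> i)\<close> of a power of the closed sine curve. Writing the curve as
  \<open>u * v = u * sin (1 / u)\<close> rather than by cases makes it the zero set of a continuous function: the right
  side extends continuously to \<open>u = 0\<close>, where its value \<open>0\<close> leaves \<open>v\<close> unconstrained.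
\<close>
definition sine_pullback ::
    "'a topology \<Rightarrow> 'i set \<Rightarrow> ('i \<Rightarrow> 'a \<Rightarrow> real) \<Rightarrow> ('a \<times> ('i \<Rightarrow> real)) topology" where
  "sine_pullback X I \<psi> =
     subtopology (prod_topology X (product_topology (\<lambda>_. top_of_set {-1..1}) I))
       {(x, z). \<forall>i\<in>I. \<psi> i x * z i = \<psi> i x * sin (1 / \<psi> i x)}"

lemma topspace_sine_pullback:
  "topspace (sine_pullback X I \<psi>) =
     {(x, z). x \<in> topspace X \<and> z \<in> (\<Pi>\<^sub>E i\<in>I. {-1..1}) \<and>
        (\<forall>i\<in>I. \<psi> i x * z i = \<psi> i x * sin (1 / \<psi> i x))}"
  by (auto simp: sine_pullback_def)

lemma continuous_map_sine_pullback_fst: "continuous_map (sine_pullback X I \<psi>) X fst"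
  unfolding sine_pullback_def
  by (intro continuous_map_from_subtopology continuous_map_fst)

lemma continuous_map_sine_pullback_coordinate:
  assumes "i \<in> I"
  shows "continuous_map (sine_pullback X I \<psi>) euclideanreal (\<lambda>w. snd w i)"
proof -
  have "continuous_map (product_topology (\<lambda>_. top_of_set {-1..1::real}) I) euclideanreal (\<lambda>z. z i)"
    using continuous_map_product_projection[OF assms, of "\<lambda>_. top_of_set {-1..1::real}"]
    by (simp add: continuous_map_in_subtopology)
  then have "continuous_map (prod_topology X (product_topology (\<lambda>_. top_of_set {-1..1::real}) I))
          euclideanreal ((\<lambda>z. z i) \<circ> snd)"
    by (intro continuous_map_compose[OF continuous_map_snd])
  then show ?thesis
    unfolding sine_pullback_def by (auto simp: o_def intro: continuous_map_from_subtopology)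
qed

lemma sine_pullback_fst_image: "fst ` topspace (sine_pullback X I \<psi>) = topspace X"
proof
  show "topspace X \<subseteq> fst ` topspace (sine_pullback X I \<psi>)"
  proof
    fix x assume "x \<in> topspace X"
    then have "(x, \<lambda>i\<in>I. sin (1 / \<psi> i x)) \<in> topspace (sine_pullback X I \<psi>)"
      by (auto simp: topspace_sine_pullback)
    then show "x \<in> fst ` topspace (sine_pullback X I \<psi>)" by force
  qed
qed (auto simp: topspace_sine_pullback)

lemma tychonoff_sine_pullback:
  assumes "tychonoff_space X"
  shows "tychonoff_space (sine_pullback X I \<psi>)"
proof -
  have "completely_regular_space (product_topology (\<lambda>_. top_of_set {-1..1::real}) I)"
    by (simp add: completely_regular_space_product_topology completely_regular_space_subtopology
        metrizable_imp_completely_regular_space metrizable_space_euclidean)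
  moreover have "Hausdorff_space (product_topology (\<lambda>_. top_of_set {-1..1::real}) I)"
    by (simp add: Hausdorff_space_product_topology Hausdorff_space_subtopology)
  ultimately show ?thesis
    using assms unfolding tychonoff_space_def sine_pullback_def
    by (auto simp: Hausdorff_space_prod_topology completely_regular_space_prod_topology
        intro!: Hausdorff_space_subtopology completely_regular_space_subtopology)
qed

text \<open>
  The projection of \<open>X \<times> [-1, 1]\<^sup>I\<close> to \<open>X\<close> is proper because the second factor is compact, and it
  remains so on the closed subspace cut out by the sine-curve equations.
\<close>
lemma proper_map_sine_pullback_fst:
  assumes \<psi>: "\<And>i. i \<in> I \<Longrightarrow> continuous_map X euclideanreal (\<psi> i)"
  shows "proper_map (sine_pullback X I \<psi>) X fst"
proof -
  let ?K = "product_topology (\<lambda>_. top_of_set {-1..1::real}) I"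
  let ?P = "prod_topology X ?K"
  have K: "compact_space ?K"
    by (simp add: compact_space_product_topology compact_space_subtopology)
  have fst: "proper_map ?P X fst"
    unfolding proper_map_def
  proof (intro conjI ballI)
    show "closed_map ?P X fst" using K by (rule closed_map_fst)
    fix x assume x: "x \<in> topspace X"
    have "{w \<in> topspace ?P. fst w = x} = {x} \<times> topspace ?K"
      using x by auto
    then show "compactin ?P {w \<in> topspace ?P. fst w = x}"
      using x K by (simp add: compactin_Times compact_space_def)
  qed
  define E where "E i = {w \<in> topspace ?P. \<psi> i (fst w) * snd w i = \<psi> i (fst w) * sin (1 / \<psi> i (fst w))}" for i
  have "closedin ?P (E i)" if i: "i \<in> I" for i
  proof -
    have c1: "continuous_map ?P euclideanreal (\<lambda>w. \<psi> i (fst w))"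
      using continuous_map_compose[OF continuous_map_fst \<psi>[OF i], of ?K] by (simp add: o_def)
    have "continuous_map ?K euclideanreal (\<lambda>z. z i)"
      using continuous_map_product_projection[OF i, of "\<lambda>_. top_of_set {-1..1::real}"]
      by (simp add: continuous_map_in_subtopology)
    then have c2: "continuous_map ?P euclideanreal (\<lambda>w. snd w i)"
      using continuous_map_compose[OF continuous_map_snd, of ?K euclideanreal "\<lambda>z. z i" X]
      by (simp add: o_def)
    have "continuous_map euclideanreal euclideanreal (\<lambda>u. u * sin (1 / u))"
      using continuous_on_mult_sin_inverse by simp
    then have c3: "continuous_map ?P euclideanreal (\<lambda>w. \<psi> i (fst w) * sin (1 / \<psi> i (fst w)))"
      using continuous_map_compose[OF c1, of euclideanreal "\<lambda>u. u * sin (1 / u)"] by (simp add: o_def)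
    show ?thesis
      unfolding E_def
      by (rule closedin_continuous_maps_eq[OF _ continuous_map_real_mult[OF c1 c2] c3]) simp
  qed
  then have "closedin ?P (\<Inter>(insert (topspace ?P) (E ` I)))"
    by (intro closedin_Inter) (auto simp del: topspace_prod_topology)
  then have "closedin ?P (topspace ?P \<inter> \<Inter>(E ` I))"
    by (simp only: Inter_insert)
  moreover have "sine_pullback X I \<psi> = subtopology ?P (topspace ?P \<inter> \<Inter>(E ` I))"
  proof -
    let ?G = "{(x, z). \<forall>i\<in>I. \<psi> i x * z i = \<psi> i x * sin (1 / \<psi> i x)}"
    have eq: "topspace ?P \<inter> \<Inter>(E ` I) = topspace ?P \<inter> ?G"
      by (auto simp: E_def)
    show ?thesis
      unfolding sine_pullback_def eq by (rule subtopology_restrict[symmetric])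
  qed
  ultimately have "proper_map (sine_pullback X I \<psi>) ?P id"
    by (metis closed_Int_compactin proper_map_inclusion closedin_subset)
  from proper_map_compose[OF this fst] show ?thesis by simp
qed

text \<open>
  For fixed \<open>x\<close> the defining equations are linear in \<open>z\<close>, so the fibre is convex and the straight line
  between two of its points stays in it.
\<close>
lemma path_component_of_sine_pullback_fibre:
  assumes "(x, z) \<in> topspace (sine_pullback X I \<psi>)" "(x, z') \<in> topspace (sine_pullback X I \<psi>)"
  shows "path_component_of (sine_pullback X I \<psi>) (x, z) (x, z')"
proof -
  define g where "g t = (x, \<lambda>i\<in>I. (1 - t) * z i + t * z' i)" for t
  have ext: "z \<in> extensional I" "z' \<in> extensional I" and x: "x \<in> topspace X"
    using assms by (auto simp: topspace_sine_pullback PiE_def)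
  have z: "z i \<in> {-1..1}" "z' i \<in> {-1..1}" if "i \<in> I" for i
    using assms that by (auto simp: topspace_sine_pullback)
  have zi: "(1 - t) * z i + t * z' i \<in> {-1..1}" if "i \<in> I" "t \<in> {0..1}" for i t
    using convexD_alt[of "{-1..1::real}" "z i" "z' i" t] z[OF that(1)] that(2) by auto
  have "continuous_map (top_of_set {0..1}) (prod_topology X (product_topology (\<lambda>_. top_of_set {-1..1}) I)) g"
    unfolding continuous_map_pairwise
  proof
    show "continuous_map (top_of_set {0..1}) X (fst \<circ> g)"
      using x by (simp add: g_def o_def)
    have "continuous_map (top_of_set {0..1}) (top_of_set {-1..1}) (\<lambda>t. (1 - t) * z i + t * z' i)"
      if "i \<in> I" for i
      using zi[OF that] by (auto simp: intro!: continuous_intros)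
    then show "continuous_map (top_of_set {0..1}) (product_topology (\<lambda>_. top_of_set {-1..1}) I) (snd \<circ> g)"
      by (auto simp: continuous_map_componentwise g_def)
  qed
  moreover have "\<psi> i x * ((1 - t) * z i + t * z' i) = \<psi> i x * sin (1 / \<psi> i x)" if "i \<in> I" for i t
  proof -
    have "\<psi> i x * z i = \<psi> i x * sin (1 / \<psi> i x)" "\<psi> i x * z' i = \<psi> i x * sin (1 / \<psi> i x)"
      using assms that by (auto simp: topspace_sine_pullback)
    then show ?thesis by algebra
  qed
  ultimately have "pathin (sine_pullback X I \<psi>) g"
    unfolding pathin_def sine_pullback_def
    by (auto simp: continuous_map_in_subtopology g_def)
  moreover have "g 0 = (x, z)" "g 1 = (x, z')"
    using ext by (auto simp: g_def extensional_restrict)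
  ultimately show ?thesis
    unfolding path_component_of_def by blast
qed

lemma path_component_of_sine_pullback:
  assumes \<psi>: "\<And>i. i \<in> I \<Longrightarrow> continuous_map X euclideanreal (\<psi> i)"
    and sep: "\<And>x y. \<lbrakk>x \<in> topspace X; y \<in> topspace X; x \<noteq> y\<rbrakk> \<Longrightarrow> \<exists>i\<in>I. \<psi> i x < 0 \<and> 0 < \<psi> i y"
    and w: "w \<in> topspace (sine_pullback X I \<psi>)" "w' \<in> topspace (sine_pullback X I \<psi>)"
  shows "path_component_of (sine_pullback X I \<psi>) w w' \<longleftrightarrow> fst w = fst w'"
proof
  assume "fst w = fst w'"
  moreover obtain x z x' z' where "w = (x, z)" "w' = (x', z')" by fastforce
  ultimately show "path_component_of (sine_pullback X I \<psi>) w w'"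
    using w path_component_of_sine_pullback_fibre[of x z X I \<psi> z'] by simp
next
  assume path: "path_component_of (sine_pullback X I \<psi>) w w'"
  show "fst w = fst w'"
  proof (rule ccontr)
    assume "fst w \<noteq> fst w'"
    then obtain i where i: "i \<in> I" "\<psi> i (fst w) < 0" "0 < \<psi> i (fst w')"
      using sep[of "fst w" "fst w'"] w by (auto simp: topspace_sine_pullback)
    have "continuous_map (sine_pullback X I \<psi>) euclideanreal (\<lambda>w. \<psi> i (fst w))"
      using continuous_map_compose[OF continuous_map_sine_pullback_fst \<psi>[OF i(1)], of I \<psi>]
      by (simp add: o_def)
    from path_on_sine_curve_cannot_cross[OF path this
        continuous_map_sine_pullback_coordinate[OF i(1)]] i
    show False by (force simp: topspace_sine_pullback)
  qed
qed

lemma weight_sine_pullback_le: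
  assumes B: "topology_basis X \<B>" and inf: "infinite \<B>" and I: "|I| \<le>o |\<B>|"
  shows "weight (sine_pullback X I \<psi>) \<le>o |\<B>|"
proof -
  let ?Z = "sine_pullback X I \<psi>"
  let ?K = "product_topology (\<lambda>_. top_of_set {-1..1::real}) I"
  define cylX where "cylX U = {w \<in> topspace ?Z. fst w \<in> U}" for U
  define cyl where "cyl = (\<lambda>(i, a, b). {w \<in> topspace ?Z. snd w i \<in> {a<..<b}})"
  \<comment> \<open>Cylinders over basic sets of \<open>X\<close>, and over rational intervals in a single coordinate, form a
    subbase; there are at most \<open>|\<B>|\<close> of them.\<close>
  define \<S> where "\<S> = cylX ` \<B> \<union> cyl ` (I \<times> \<rat> \<times> \<rat>)"
  show ?thesis
  proof (rule weight_le_of_subbase[where \<S> = \<S>])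
    fix U assume "U \<in> \<S>"
    then consider V where "V \<in> \<B>" "U = cylX V" | i a b where "i \<in> I" "U = cyl (i, a, b)"
      by (auto simp: \<S>_def)
    then show "openin ?Z U"
    proof cases
      case 1
      then have "openin X V" using B by (auto simp: topology_basis_iff)
      then show ?thesis
        unfolding 1 cylX_def
        by (rule openin_continuous_map_preimage[OF continuous_map_sine_pullback_fst])
    next
      case 2
      have "openin ?Z {w \<in> topspace ?Z. snd w i \<in> {a<..<b}}"
        using continuous_map_sine_pullback_coordinate[OF 2(1)]
        by (rule openin_continuous_map_preimage) auto
      with 2 show ?thesis by (simp add: cyl_def)
    qed
  next
    fix W w assume W: "openin ?Z W" "w \<in> W"
    then have wZ: "w \<in> topspace ?Z" using openin_subset by blast
    obtain x z where w: "w = (x, z)" by fastforce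
    obtain T where T: "openin (prod_topology X ?K) T" "W = T \<inter> {(x, z). \<forall>i\<in>I. \<psi> i x * z i = \<psi> i x * sin (1 / \<psi> i x)}"
      using W(1) by (auto simp: sine_pullback_def openin_subtopology)
    have "(x, z) \<in> T" using T(2) W(2) w by blast
    have "\<exists>U V. openin X U \<and> openin ?K V \<and> x \<in> U \<and> z \<in> V \<and> U \<times> V \<subseteq> T"
      by (rule openin_prod_topology_alt[THEN iffD1, OF T(1), rule_format]) (rule \<open>(x, z) \<in> T\<close>)
    then obtain U V where UV: "openin X U" "openin ?K V" "x \<in> U" "z \<in> V" "U \<times> V \<subseteq> T"
      by (elim exE conjE) (rule that)
    obtain U' where U': "U' \<in> \<B>" "x \<in> U'" "U' \<subseteq> U"
      using B UV(1,3) unfolding topology_basis_iff by blast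
    have "\<exists>Q. finite {i \<in> I. Q i \<noteq> topspace (top_of_set {-1..1::real})} \<and>
        (\<forall>i\<in>I. openin (top_of_set {-1..1}) (Q i)) \<and> z \<in> Pi\<^sub>E I Q \<and> Pi\<^sub>E I Q \<subseteq> V"
      using UV(2) \<open>z \<in> V\<close> unfolding openin_product_topology_alt by (rule bspec)
    then obtain Q where Q: "finite {i \<in> I. Q i \<noteq> {-1..1}}"
      "\<And>i. i \<in> I \<Longrightarrow> openin (top_of_set {-1..1}) (Q i)" "z \<in> Pi\<^sub>E I Q" "Pi\<^sub>E I Q \<subseteq> V"
      unfolding topspace_euclidean_subtopology by blast
    define J where "J = {i \<in> I. Q i \<noteq> {-1..1}}"
    have "\<exists>a b. a \<in> \<rat> \<and> b \<in> \<rat> \<and> z i \<in> {a<..<b} \<and> {a<..<b} \<inter> {-1..1} \<subseteq> Q i" if i: "i \<in> I" for i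
    proof -
      obtain O' where O: "open O'" "Q i = {-1..1} \<inter> O'"
        using Q(2)[OF i] by (auto simp: openin_open)
      have "z i \<in> O'" using Q(3) i O by auto
      then obtain e where e: "e > 0" "ball (z i) e \<subseteq> O'"
        using O(1) open_contains_ball by blast
      obtain a where a: "a \<in> \<rat>" "z i - e < a" "a < z i"
        using Rats_dense_in_real[of "z i - e" "z i"] e by auto
      obtain b where b: "b \<in> \<rat>" "z i < b" "b < z i + e"
        using Rats_dense_in_real[of "z i" "z i + e"] e by auto
      have "{a<..<b} \<subseteq> ball (z i) e"
        using a b by (auto simp: dist_real_def)
      with a b e O show ?thesis by (intro exI[of _ a] exI[of _ b]) auto
    qed
    then obtain a b where ab: "\<And>i. i \<in> I \<Longrightarrow> a i \<in> \<rat> \<and> b i \<in> \<rat> \<and> z i \<in> {a i<..<b i} \<and> {a i<..<b i} \<inter> {-1..1} \<subseteq> Q i"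
      by metis
    define F where "F = insert (cylX U') ((\<lambda>i. cyl (i, a i, b i)) ` J)"
    have "finite F" using Q(1) by (simp add: F_def J_def)
    moreover have "F \<subseteq> \<S>" using ab U' by (auto simp: F_def \<S>_def J_def)
    moreover have "w \<in> topspace ?Z \<inter> \<Inter>F"
      using wZ w U' ab by (auto simp: F_def cylX_def cyl_def J_def)
    moreover have "topspace ?Z \<inter> \<Inter>F \<subseteq> W"
    proof
      fix w' assume w': "w' \<in> topspace ?Z \<inter> \<Inter>F"
      obtain x' z' where p: "w' = (x', z')" by fastforce
      have z': "z' \<in> (\<Pi>\<^sub>E i\<in>I. {-1..1})" and mem: "\<forall>i\<in>I. \<psi> i x' * z' i = \<psi> i x' * sin (1 / \<psi> i x')"
        using w' p by (auto simp: topspace_sine_pullback)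
      have "x' \<in> U'" using w' p by (auto simp: F_def cylX_def)
      moreover have "z' i \<in> Q i" if i: "i \<in> I" for i
      proof (cases "i \<in> J")
        case True
        then have "z' i \<in> {a i<..<b i}" using w' p by (auto simp: F_def cyl_def)
        then show ?thesis using ab[OF i] z' i by auto
      next
        case False
        then show ?thesis using z' i by (auto simp: J_def)
      qed
      then have "z' \<in> Pi\<^sub>E I Q" using z' by (auto simp: PiE_iff)
      ultimately show "w' \<in> W" using U' UV(5) Q(4) T(2) p mem by auto
    qed
    ultimately show "\<exists>F. finite F \<and> F \<subseteq> \<S> \<and> w \<in> topspace ?Z \<inter> \<Inter>F \<and> topspace ?Z \<inter> \<Inter>F \<subseteq> W"
      by blast
  next
    have "countable (\<rat> \<times> \<rat> :: (real \<times> real) set)"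
      by (intro countable_SIGMA countable_rat)
    then have "|\<rat> \<times> \<rat> :: (real \<times> real) set| \<le>o |UNIV :: nat set|"
      unfolding countable_def using card_of_ordLeq by blast
    also have "|UNIV :: nat set| \<le>o |\<B>|"
      using inf by (simp add: infinite_iff_card_of_nat)
    finally have "|\<rat> \<times> \<rat> :: (real \<times> real) set| \<le>o |\<B>|" .
    then have "|I \<times> \<rat> \<times> \<rat> :: ('b \<times> real \<times> real) set| \<le>o |\<B>|"
      using card_of_Sigma_ordLeq_infinite[OF inf I, of "\<lambda>_. \<rat> \<times> \<rat>"] by blast
    then have "|cyl ` (I \<times> \<rat> \<times> \<rat>)| \<le>o |\<B>|"
      using card_of_image ordLeq_transitive by blast
    moreover have "|cylX ` \<B>| \<le>o |\<B>|" by (rule card_of_image)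
    ultimately show "|\<S>| \<le>o |\<B>|"
      unfolding \<S>_def using inf by (simp add: card_of_Un_ordLeq_infinite_Field)
  qed (rule inf)
qed

section \<open>Separating functions\<close>

text \<open>
  For a pair \<open>(U, V)\<close> of basic sets pick one function that is negative on \<open>U\<close> and positive on \<open>V\<close>, if
  there is any. Such pairs occur around any two distinct points, by complete regularity, and
  \<open>\<B> \<times> \<B>\<close> can be reindexed by the infinite set \<open>\<B>\<close>. Indexing by \<open>\<B>\<close> itself keeps the index type at
  \<open>'a set\<close>.
\<close>
lemma exists_separating_family:
  assumes X: "tychonoff_space X" and B: "topology_basis X \<B>" and inf: "infinite \<B>"
  shows "\<exists>\<psi> :: 'a set \<Rightarrow> 'a \<Rightarrow> real.
           (\<forall>b\<in>\<B>. continuous_map X euclideanreal (\<psi> b)) \<and>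
           (\<forall>x\<in>topspace X. \<forall>y\<in>topspace X. x \<noteq> y \<longrightarrow> (\<exists>b\<in>\<B>. \<psi> b x < 0 \<and> 0 < \<psi> b y))"
proof -
  define sep where "sep U V f \<longleftrightarrow> continuous_map X euclideanreal f \<and>
    (\<forall>u\<in>U. f u < 0) \<and> (\<forall>v\<in>V. 0 < f v)" for U V :: "'a set" and f :: "'a \<Rightarrow> real"
  \<comment> \<open>The zero function for the remaining pairs keeps every member of the family continuous.\<close>
  define \<phi> where "\<phi> = (\<lambda>(U, V). if \<exists>f. sep U V f then SOME f. sep U V f else (\<lambda>_. 0))"
  have \<phi>: "sep U V (\<phi> (U, V))" if "sep U V f" for U V f
    using that someI[of "sep U V" f] by (auto simp: \<phi>_def)
  have cont: "continuous_map X euclideanreal (\<phi> (U, V))" for U V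
  proof (cases "\<exists>f. sep U V f")
    case True
    then show ?thesis using \<phi> by (auto simp: sep_def)
  next
    case False
    then have "\<phi> (U, V) = (\<lambda>_. 0)"
      unfolding \<phi>_def prod.case by (rule if_not_P)
    then show ?thesis by simp
  qed
  have "|\<B> \<times> \<B>| =o |\<B>|"
    using inf by (rule card_of_Times_same_infinite)
  then obtain \<sigma> where \<sigma>: "bij_betw \<sigma> \<B> (\<B> \<times> \<B>)"
    using card_of_ordIso ordIso_symmetric by blast
  show ?thesis
  proof (intro exI conjI ballI impI)
    show "continuous_map X euclideanreal (\<phi> (\<sigma> b))" for b
      using cont by (cases "\<sigma> b") auto
    fix x y assume xy: "x \<in> topspace X" "y \<in> topspace X" "x \<noteq> y"
    have "closedin X {y}"
      using X xy by (simp add: tychonoff_space_def closedin_Hausdorff_sing_eq)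
    then have "\<exists>f. continuous_map X euclideanreal f \<and> f x = 0 \<and> f ` {y} \<subseteq> {1}"
      using X xy unfolding tychonoff_space_def completely_regular_space_alt by blast
    then obtain f where f: "continuous_map X euclideanreal f" "f x = 0" "f y = (1::real)"
      by auto
    define g where "g w = f w - 1 / 2" for w
    have g: "continuous_map X euclideanreal g"
      unfolding g_def by (intro continuous_intros f)
    have "openin X {w \<in> topspace X. g w \<in> {..<0}}" "openin X {w \<in> topspace X. g w \<in> {0<..}}"
      by (rule openin_continuous_map_preimage[OF g], simp)+
    moreover have "x \<in> {w \<in> topspace X. g w \<in> {..<0}}" "y \<in> {w \<in> topspace X. g w \<in> {0<..}}"
      using xy f by (auto simp: g_def)
    ultimately obtain U V where UV: "U \<in> \<B>" "x \<in> U" "U \<subseteq> {w \<in> topspace X. g w \<in> {..<0}}"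
      "V \<in> \<B>" "y \<in> V" "V \<subseteq> {w \<in> topspace X. g w \<in> {0<..}}"
      using B unfolding topology_basis_iff by meson
    then have "sep U V g" using g by (auto simp: sep_def)
    then have "sep U V (\<phi> (U, V))" by (rule \<phi>)
    moreover obtain b where "b \<in> \<B>" "\<sigma> b = (U, V)"
      using \<sigma> UV by (metis (no_types, lifting) SigmaI bij_betw_def imageE)
    ultimately show "\<exists>b\<in>\<B>. \<phi> (\<sigma> b) x < 0 \<and> 0 < \<phi> (\<sigma> b) y"
      using UV by (intro bexI[of _ b]) (simp_all add: sep_def)
  qed
qed

section \<open>Recognising the path-component space\<close>

lemma homeomorphic_copy_on_image:
  assumes "inj_on e (topspace Z)"
  shows "\<exists>Y. homeomorphic_map Z Y e"
proof -
  let ?S = "e ` topspace Z" and ?d = "inv_into (topspace Z) e"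
  let ?Y = "pullback_topology ?S ?d Z"
  have d: "?d (e z) = z" if "z \<in> topspace Z" for z
    using assms that by simp
  have eq: "?d -` U \<inter> ?S = e ` U" if "U \<subseteq> topspace Z" for U
    using that d by (force simp: image_iff)
  have opn: "openin ?Y V \<longleftrightarrow> (\<exists>U. openin Z U \<and> V = e ` U)" for V
    unfolding openin_pullback_topology using eq openin_subset by metis
  have top: "topspace ?Y = ?S"
    unfolding topspace_pullback_topology using eq[of "topspace Z"] by simp
  have "continuous_map Z ?Y e"
    unfolding continuous_map_def
  proof (intro conjI allI impI)
    fix V assume "openin ?Y V"
    then obtain U where U: "openin Z U" "V = e ` U" by (auto simp: opn)
    then have "{z \<in> topspace Z. e z \<in> V} = U"
      using assms openin_subset[OF U(1)] by (auto simp: inj_on_def)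
    with U show "openin Z {z \<in> topspace Z. e z \<in> V}" by simp
  qed (simp add: top)
  moreover have "open_map Z ?Y e"
    unfolding open_map_def opn by blast
  ultimately show ?thesis
    using assms top bijective_open_imp_homeomorphic_map by blast
qed

text \<open>
  Both \<open>f\<close>, as a closed continuous surjection, and the map to the path-component space are quotient
  maps, and they identify the same points; so the induced bijection is a homeomorphism.
\<close>
lemma homeomorphic_path_component_space_of_perfect_map:
  assumes f: "continuous_map Y X f" "proper_map Y X f" "f ` topspace Y = topspace X"
    and path: "\<And>y y'. \<lbrakk>y \<in> topspace Y; y' \<in> topspace Y\<rbrakk> \<Longrightarrow> path_component_of Y y y' \<longleftrightarrow> f y = f y'"
  obtains h where "homeomorphic_map (path_component_space Y) X h"
    and "\<And>y. y \<in> topspace Y \<Longrightarrow> h (path_component_of_set Y y) = f y"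
proof -
  have same: "path_component_of_set Y y = path_component_of_set Y y' \<longleftrightarrow> f y = f y'"
    if "y \<in> topspace Y" "y' \<in> topspace Y" for y y'
    using that path path_component_of_equiv by (metis Collect_inj)
  obtain h where h: "continuous_map (path_component_space Y) X h"
    "\<And>y. y \<in> topspace Y \<Longrightarrow> h (path_component_of_set Y y) = f y"
    using quotient_map_lift_exists[OF quotient_map_path_component_of_set f(1)] same by metis
  have "quotient_map Y X f"
    using f by (auto simp: proper_map_def intro: continuous_closed_imp_quotient_map)
  then have "quotient_map Y X (h \<circ> path_component_of_set Y)"
    by (rule quotient_map_eq) (simp add: h)
  then have "quotient_map (path_component_space Y) X h"
    using quotient_map_compose_eq[OF quotient_map_path_component_of_set] by blast
  moreover have "inj_on h (topspace (path_component_space Y))"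
    using same h(2) by (auto simp: inj_on_def topspace_path_component_space path_components_of_def)
  ultimately have "homeomorphic_map (path_component_space Y) X h"
    by (simp add: homeomorphic_map_def)
  with h(2) show thesis by (rule that[rotated])
qed

text \<open>
  Everything asked of \<open>Z\<close> is invariant under homeomorphism, so an injection of its points into the
  type \<open>'c\<close> is all that is needed to move it there.
\<close>
lemma realises_path_component_space:
  fixes Z :: "'b topology" and X :: "'a topology" and e :: "'b \<Rightarrow> 'c"
  assumes Z: "tychonoff_space Z" and weight: "weight Z =o weight X"
    and f: "continuous_map Z X f" "proper_map Z X f" "f ` topspace Z = topspace X"
    and path: "\<And>w w'. \<lbrakk>w \<in> topspace Z; w' \<in> topspace Z\<rbrakk> \<Longrightarrow> path_component_of Z w w' \<longleftrightarrow> f w = f w'"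
    and e: "inj_on e (topspace Z)"
  shows "\<exists>(Y :: 'c topology) h.
           tychonoff_space Y \<and> weight Y =o weight X \<and>
           homeomorphic_map (path_component_space Y) X h \<and>
           hausdorff_perfect_map Y X (h \<circ> path_component_of_set Y)"
proof -
  obtain Y where Y: "homeomorphic_map Z Y e"
    using homeomorphic_copy_on_image[OF e] by blast
  then obtain d where d: "homeomorphic_maps Y Z d e"
    using homeomorphic_map_maps homeomorphic_maps_sym by blast
  then have dm: "homeomorphic_map Y Z d" by (simp add: homeomorphic_maps_map)
  have "Z homeomorphic_space Y"
    using Y homeomorphic_map_imp_homeomorphic_space by blast
  then have tych: "tychonoff_space Y"
    using Z homeomorphic_completely_regular_space homeomorphic_Hausdorff_space
    unfolding tychonoff_space_def by blast
  have wt: "weight Y =o weight X"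
    using weight_homeomorphic[OF Y] weight by (rule ordIso_transitive)
  have p1: "continuous_map Y X (f \<circ> d)"
    using dm f(1) by (meson continuous_map_compose homeomorphic_imp_continuous_map)
  have p2: "proper_map Y X (f \<circ> d)"
    using dm f(2) by (meson proper_map_compose homeomorphic_imp_proper_map)
  have p3: "(f \<circ> d) ` topspace Y = topspace X"
    using dm f(3) by (metis homeomorphic_imp_surjective_map image_comp)
  have p4: "path_component_of Y y y' \<longleftrightarrow> (f \<circ> d) y = (f \<circ> d) y'"
    if y: "y \<in> topspace Y" "y' \<in> topspace Y" for y y'
  proof -
    have c: "continuous_map Y Z d" "continuous_map Z Y e"
      and ed: "e (d y) = y" "e (d y') = y'"
      and "d y \<in> topspace Z" "d y' \<in> topspace Z"
      using d y by (auto simp: homeomorphic_maps_def continuous_map_def)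
    moreover have "path_component_of Y y y' \<longleftrightarrow> path_component_of Z (d y) (d y')"
      using path_component_of_continuous_image[OF c(1), of y y']
        path_component_of_continuous_image[OF c(2), of "d y" "d y'"] ed by auto
    ultimately show ?thesis using path by simp
  qed
  obtain h where h: "homeomorphic_map (path_component_space Y) X h"
    "\<And>y. y \<in> topspace Y \<Longrightarrow> h (path_component_of_set Y y) = (f \<circ> d) y"
    using homeomorphic_path_component_space_of_perfect_map[OF p1 p2 p3 p4] by metis
  have "continuous_map Y X (h \<circ> path_component_of_set Y)"
    using p1 by (rule continuous_map_eq) (use h in auto)
  moreover have "proper_map Y X (h \<circ> path_component_of_set Y)"
  proof -
    have eq: "{y \<in> topspace Y. (h \<circ> path_component_of_set Y) y = x} = {y \<in> topspace Y. (f \<circ> d) y = x}" for x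
      using h(2) by auto
    have cl: "closed_map Y X (h \<circ> path_component_of_set Y)"
      by (rule closed_map_eq[of _ _ "f \<circ> d"]) (use p2 h(2) in \<open>auto simp: proper_map_def\<close>)
    show ?thesis
      using p2 cl unfolding proper_map_def eq by blast
  qed
  ultimately have "hausdorff_perfect_map Y X (h \<circ> path_component_of_set Y)"
    using tych by (simp add: hausdorff_perfect_map_def tychonoff_space_def)
  with tych wt h(1) show ?thesis by blast
qed

text \<open>
  A point of a Hausdorff space is determined by the basic sets that contain it.
\<close>
lemma finite_topology_basis_imp_finite:
  assumes "Hausdorff_space X" "topology_basis X \<B>" "finite \<B>"
  shows "finite (topspace X)"
proof (rule inj_on_finite)
  show "inj_on (\<lambda>x. {U \<in> \<B>. x \<in> U}) (topspace X)"
  proof (rule inj_onI, rule ccontr)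
    fix x y assume xy: "x \<in> topspace X" "y \<in> topspace X" "x \<noteq> y"
      and eq: "{U \<in> \<B>. x \<in> U} = {U \<in> \<B>. y \<in> U}"
    obtain W where "openin X W" "x \<in> W" "y \<notin> W"
      using assms(1) xy unfolding Hausdorff_space_def disjnt_iff by metis
    then obtain U where "U \<in> \<B>" "x \<in> U" "U \<subseteq> W"
      using assms(2) unfolding topology_basis_iff by blast
    with eq \<open>y \<notin> W\<close> show False by blast
  qed
  show "(\<lambda>x. {U \<in> \<B>. x \<in> U}) ` topspace X \<subseteq> Pow \<B>" by blast
  show "finite (Pow \<B>)" using assms(3) by simp
qed

(* HOL cannot quantify existentially over types, so Y needs a fixed carrier type. The type
   'a set => real costs no generality: a basis of X is a set of subsets of 'a, so every Tychonoff
   space of weight w(X) embeds into the product of copies of the reals indexed by 'a set. *)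
theorem theorem1p1:
  fixes X :: "'a topology"
  assumes "tychonoff_space X"
  shows "\<exists>(Y :: ('a set \<Rightarrow> real) topology) h.
           tychonoff_space Y \<and>
           weight Y =o weight X \<and>
           homeomorphic_map (path_component_space Y) X h \<and>
           hausdorff_perfect_map Y X (h \<circ> path_component_of_set Y)"
proof -
  obtain \<B> where B: "topology_basis X \<B>" "weight X = |\<B>|"
    using weight_basis_exists by blast
  show ?thesis
  proof (cases "finite \<B>")
    case True
    have "finite (topspace X)"
      using finite_topology_basis_imp_finite assms B(1) True by (auto simp: tychonoff_space_def)
    then have X: "X = discrete_topology (topspace X)"
      using assms Hausdorff_imp_t1_space finite_t1_space_imp_discrete_topology
      unfolding tychonoff_space_def by blast
    show ?thesis
    proof (rule realises_path_component_space[where Z = X and f = id and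
          e = "\<lambda>x A. if A = {x} then 1 else 0"])
      show "weight X =o weight X"
        unfolding B(2) by (rule card_of_refl)
      show "path_component_of X w w' \<longleftrightarrow> id w = id w'" if "w \<in> topspace X" for w w'
        using that by (subst X) auto
      show "inj_on (\<lambda>x A. if A = {x} then 1 else (0::real)) (topspace X)"
        by (rule inj_onI) (metis singleton_inject zero_neq_one)
    qed (use assms in \<open>simp_all add: proper_map_id\<close>)
  next
    case False
    obtain \<psi> :: "'a set \<Rightarrow> 'a \<Rightarrow> real"
      where \<psi>: "\<forall>b\<in>\<B>. continuous_map X euclideanreal (\<psi> b)"
        and sep: "\<forall>x\<in>topspace X. \<forall>y\<in>topspace X. x \<noteq> y \<longrightarrow> (\<exists>b\<in>\<B>. \<psi> b x < 0 \<and> 0 < \<psi> b y)"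
      using exists_separating_family[OF assms B(1) False] by (elim exE conjE) (rule that)
    let ?Z = "sine_pullback X \<B> \<psi>"
    \<comment> \<open>\<open>e\<close> records \<open>x\<close> by a shift of the coordinate \<open>{x}\<close>. Within \<open>\<B>\<close> coordinates lie in \<open>[-1, 1]\<close>,
      which is disjoint from its translate by \<open>3\<close>; outside \<open>\<B>\<close> they all have the same value
      \<open>undefined\<close>, so a shift is visible there too.\<close>
    define e :: "'a \<times> ('a set \<Rightarrow> real) \<Rightarrow> 'a set \<Rightarrow> real"
      where "e = (\<lambda>(x, z) A. z A + (if A = {x} then 3 else 0))"
    have proper: "proper_map ?Z X fst"
      by (rule proper_map_sine_pullback_fst) (use \<psi> in blast)
    show ?thesis
    proof (rule realises_path_component_space[where Z = ?Z and f = fst and e = e])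
      show "tychonoff_space ?Z" using assms by (rule tychonoff_sine_pullback)
      have "weight ?Z \<le>o weight X"
        unfolding B(2) using B(1) False by (rule weight_sine_pullback_le) simp
      moreover have "weight X \<le>o weight ?Z"
        by (rule weight_perfect_image_le[OF continuous_map_sine_pullback_fst proper
              sine_pullback_fst_image]) (simp add: B(2) False)
      ultimately show "weight ?Z =o weight X" by (simp add: ordIso_iff_ordLeq)
      show "path_component_of ?Z w w' \<longleftrightarrow> fst w = fst w'"
        if "w \<in> topspace ?Z" "w' \<in> topspace ?Z" for w w'
        by (rule path_component_of_sine_pullback) (use \<psi> sep that in simp_all)
      show "inj_on e (topspace ?Z)"
      proof (rule inj_onI)
        fix w w' assume w: "w \<in> topspace ?Z" "w' \<in> topspace ?Z" and eq: "e w = e w'"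
        obtain x z x' z' where p: "w = (x, z)" "w' = (x', z')" by fastforce
        have "x = x'"
        proof (rule ccontr)
          assume "x \<noteq> x'"
          then have sum: "z {x} + 3 = z' {x}"
            using fun_cong[OF eq, of "{x}"] by (auto simp: e_def p)
          show False
          proof (cases "{x} \<in> \<B>")
            case True
            then have "z {x} \<in> {-1..1}" "z' {x} \<in> {-1..1}"
              using w p by (auto simp: topspace_sine_pullback)
            with sum show False by simp
          next
            case False
            then have "z {x} = z' {x}"
              using w p by (auto simp: topspace_sine_pullback PiE_def extensional_def)
            with sum show False by simp
          qed
        qed
        moreover have "z = z'"
          using eq \<open>x = x'\<close> by (auto simp: e_def p fun_eq_iff)
        ultimately show "w = w'" by (simp add: p)
      qed
    qed (simp_all add: proper continuous_map_sine_pullback_fst sine_pullback_fst_image)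
  qed
qed

end
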